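(* The map $\Phi\colon\mathcal{P}/\mathrm{SL}_2(\mathbb{Z})\longrightarrow \mathbf{FR}_\infty$, which sends the $\mathrm{SL}_2(\mathbb{Z})$-orbit of a bi-infinite path $\gamma$ to $\pm\mathbf{M}$, where $m_{i,j}=a_jb_i-b_ja_i$ and $a_i/b_i$ are the suitably normalised vertices of $\gamma$, is a one-to-one correspondence (a bijection).
   Context: An $\mathrm{SL}_2$-tiling is a function $\mathbf{M}\colon\mathbb{Z}\times\mathbb{Z}\to\mathbb{Z}$, with $m_{i,j}=\mathbf{M}(i,j)$, such that $m_{i,j}m_{i+1,j+1}-m_{i,j+1}m_{i+1,j}=1$ for all $i,j\in\mathbb{Z}$. It is tame if every $3\times 3$ submatrix of consecutive rows and columns has determinant $0$. An infinite frieze is an $\mathrm{SL}_2$-tiling $\mathbf{M}$ with $m_{j,i}=-m_{i,j}$ for all $i,j\in\mathbb{Z}$. $\mathbf{FR}_\infty$ is the set of all tame infinite friezes, with $\mathbf{M}$ and $-\mathbf{M}$ identified; elements are written $\pm\mathbf{M}$. A reduced rational is an expression $a/b$ with $a,b$ coprime integers, where $1/0$ and $(-1)/0$ are allowed and both represent $\infty$. The Farey graph $\mathcal{F}$ has vertex set $\mathbb{Q}_\infty=\mathbb{Q}\cup\{\infty\}$, with reduced rationals $a/b$ and $c/d$ adjacent if and only if $ad-bc=\pm1$. A bi-infinite path in $\mathcal{F}$ is a sequence $\langle\dots,v_{-1},v_0,v_1,v_2,\dots\rangle$ of vertices indexed by $\mathbb{Z}$ with $v_i$ adjacent to $v_{i+1}$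 for all $i$; $\mathcal{P}$ is the set of all of them. $\mathrm{SL}_2(\mathbb{Z})$ acts on $\mathbb{Q}_\infty$ by Möbius transformations $z\mapsto\frac{az+b}{cz+d}$, preserving adjacency, hence acts on $\mathcal{P}$ vertexwise. Given $\gamma\in\mathcal{P}$, write its vertices as reduced rationals $v_i=a_i/b_i$ with $a_ib_{i+1}-a_{i+1}b_i=1$ for all $i\in\mathbb{Z}$ (possible in exactly two ways, differing by a global sign), and put $m_{i,j}=a_jb_i-b_ja_i$. The resulting $\pm\mathbf{M}$ depends only on the $\mathrm{SL}_2(\mathbb{Z})$-orbit of $\gamma$; this is $\Phi$ of that orbit. *)

theory Defs
  imports "HOL-Analysis.Determinants"
begin

definition SL2_tiling :: "(int \<Rightarrow> int \<Rightarrow> int) \<Rightarrow> bool" where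
  "SL2_tiling M \<longleftrightarrow> (\<forall>i j. M i j * M (i + 1) (j + 1) - M i (j + 1) * M (i + 1) j = 1)"

definition tame :: "(int \<Rightarrow> int \<Rightarrow> int) \<Rightarrow> bool" where
  "tame M \<longleftrightarrow> (\<forall>i j. det (vector
     [vector [M i j, M i (j + 1), M i (j + 2)],
      vector [M (i + 1) j, M (i + 1) (j + 1), M (i + 1) (j + 2)],
      vector [M (i + 2) j, M (i + 2) (j + 1), M (i + 2) (j + 2)]] :: int ^ 3 ^ 3) = 0)"

definition infinite_frieze :: "(int \<Rightarrow> int \<Rightarrow> int) \<Rightarrow> bool" where
  "infinite_frieze M \<longleftrightarrow> SL2_tiling M \<and> (\<forall>i j. M j i = - M i j)"

definition tame_friezes :: "(int \<Rightarrow> int \<Rightarrow> int) set" where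
  "tame_friezes = {M. infinite_frieze M \<and> tame M}"

definition sign_rel :: "((int \<Rightarrow> int \<Rightarrow> int) \<times> (int \<Rightarrow> int \<Rightarrow> int)) set" where
  "sign_rel = {(M, N). M \<in> tame_friezes \<and> N \<in> tame_friezes \<and>
     (N = M \<or> N = (\<lambda>i j. - M i j))}"

definition FR_inf :: "(int \<Rightarrow> int \<Rightarrow> int) set set" where
  "FR_inf = tame_friezes // sign_rel"

datatype qinf = Fin rat | Infty

definition ratio :: "int \<Rightarrow> int \<Rightarrow> qinf" where
  "ratio a b = (if b = 0 then Infty else Fin (of_int a / of_int b))"

text \<open>For \<open>b = 0\<close> coprimality means \<open>a = 1\<close> or \<open>a = - 1\<close>, so \<open>Infty\<close> has exactly the
  representations \<open>1/0\<close> and \<open>(-1)/0\<close>.\<close>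

definition reduced_rep :: "qinf \<Rightarrow> int \<Rightarrow> int \<Rightarrow> bool" where
  "reduced_rep v a b \<longleftrightarrow> coprime a b \<and> v = ratio a b"

text \<open>Reduced representations are unique up to a common sign, so the choice of representatives
  is immaterial here; see \<open>farey_adj_reduced_rep\<close>.\<close>

definition farey_adj :: "qinf \<Rightarrow> qinf \<Rightarrow> bool" where
  "farey_adj u v \<longleftrightarrow> (\<exists>a b c d. reduced_rep u a b \<and> reduced_rep v c d \<and>
     (a * d - b * c = 1 \<or> a * d - b * c = - 1))"

definition farey_paths :: "(int \<Rightarrow> qinf) set" where
  "farey_paths = {\<gamma>. \<forall>i. farey_adj (\<gamma> i) (\<gamma> (i + 1))}"

definition SL2Z :: "(int ^ 2 ^ 2) set" where
  "SL2Z = {A. det A = 1}"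

fun moebius :: "int ^ 2 ^ 2 \<Rightarrow> qinf \<Rightarrow> qinf" where
  "moebius A (Fin z) =
     (if of_int (A $ 2 $ 1) * z + of_int (A $ 2 $ 2) = 0 then Infty
      else Fin ((of_int (A $ 1 $ 1) * z + of_int (A $ 1 $ 2)) /
                (of_int (A $ 2 $ 1) * z + of_int (A $ 2 $ 2))))"
| "moebius A Infty =
     (if A $ 2 $ 1 = 0 then Infty else Fin (of_int (A $ 1 $ 1) / of_int (A $ 2 $ 1)))"

definition orbit_rel :: "((int \<Rightarrow> qinf) \<times> (int \<Rightarrow> qinf)) set" where
  "orbit_rel = {(\<gamma>, \<delta>). \<gamma> \<in> farey_paths \<and> \<delta> \<in> farey_paths \<and>
     (\<exists>A\<in>SL2Z. \<delta> = (\<lambda>i. moebius A (\<gamma> i)))}"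

definition normalised_reps :: "(int \<Rightarrow> qinf) \<Rightarrow> ((int \<Rightarrow> int) \<times> (int \<Rightarrow> int)) set" where
  "normalised_reps \<gamma> = {(a, b). (\<forall>i. reduced_rep (\<gamma> i) (a i) (b i)) \<and>
     (\<forall>i. a i * b (i + 1) - a (i + 1) * b i = 1)}"

definition frieze_of :: "(int \<Rightarrow> int) \<Rightarrow> (int \<Rightarrow> int) \<Rightarrow> int \<Rightarrow> int \<Rightarrow> int" where
  "frieze_of a b = (\<lambda>i j. a j * b i - b j * a i)"

text \<open>The union runs over all representatives of an orbit and all normalisations; each of them
  contributes the same class \<open>{M, - M}\<close>, see \<open>Phi_orbit\<close>.\<close>

definition Phi :: "(int \<Rightarrow> qinf) set \<Rightarrow> (int \<Rightarrow> int \<Rightarrow> int) set" where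
  "Phi X = (\<Union>\<gamma>\<in>X. \<Union>(a, b)\<in>normalised_reps \<gamma>. sign_rel `` {frieze_of a b})"

lemma equiv_sign_rel: "equiv tame_friezes sign_rel"
  by (rule equivI) (auto simp: sign_rel_def refl_on_def sym_def trans_def)

lemma ratio_eq_iff:
  assumes "coprime a b" "coprime c d"
  shows "ratio a b = ratio c d \<longleftrightarrow> (c = a \<and> d = b) \<or> (c = - a \<and> d = - b)"
proof
  assume "ratio a b = ratio c d"
  then have eq: "a * d = c * b" and z: "b = 0 \<longleftrightarrow> d = 0"
    by (auto simp: ratio_def field_simps split: if_splits simp flip: of_int_mult)
  have "a dvd c" "c dvd a" "b dvd d" "d dvd b"
    using eq assms
    by (metis coprime_commute coprime_dvd_mult_left_iff coprime_dvd_mult_right_iff dvd_triv_left dvd_triv_right)+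
  then have "\<bar>a\<bar> = \<bar>c\<bar>" "\<bar>b\<bar> = \<bar>d\<bar>"
    by (auto intro: zdvd_antisym_abs)
  with eq z show "(c = a \<and> d = b) \<or> (c = - a \<and> d = - b)"
    by (auto simp: abs_eq_iff)
qed (auto simp: ratio_def)

lemma reduced_rep_exists: "\<exists>a b. reduced_rep v a b"
proof (cases v)
  case (Fin q)
  obtain a b where "q = Fract a b" "b > 0" "coprime a b" by (cases q)
  then have "reduced_rep v a b" using Fin
    by (simp add: reduced_rep_def ratio_def Fract_of_int_quotient)
  then show ?thesis by blast
next
  case Infty
  then have "reduced_rep v 1 0" by (simp add: reduced_rep_def ratio_def)
  then show ?thesis by blast
qed

lemma reduced_rep_unique:
  "reduced_rep v a b \<Longrightarrow> reduced_rep v c d \<longleftrightarrow> (c = a \<and> d = b) \<or> (c = - a \<and> d = - b)"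
  using ratio_eq_iff[of a b c d] by (auto simp: reduced_rep_def)

lemma farey_adj_reduced_rep:
  assumes "reduced_rep u a b" "reduced_rep v c d"
  shows "farey_adj u v \<longleftrightarrow> a * d - b * c = 1 \<or> a * d - b * c = - 1"
  unfolding farey_adj_def using reduced_rep_unique[OF assms(1)] reduced_rep_unique[OF assms(2)] by auto

lemma reduced_rep_moebius:
  assumes "A \<in> SL2Z" "reduced_rep v a b"
  shows "reduced_rep (moebius A v) (A $ 1 $ 1 * a + A $ 1 $ 2 * b) (A $ 2 $ 1 * a + A $ 2 $ 2 * b)"
proof -
  define p q r s where pqrs: "p = A $ 1 $ 1" "q = A $ 1 $ 2" "r = A $ 2 $ 1" "s = A $ 2 $ 2"
  have det: "p * s - q * r = 1"
    using assms(1) by (simp add: SL2Z_def det_2 pqrs)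
  have ab: "coprime a b" and v: "v = ratio a b" using assms(2) by (auto simp: reduced_rep_def)
  have a: "a = s * (p * a + q * b) - q * (r * a + s * b)"
    and b: "b = p * (r * a + s * b) - r * (p * a + q * b)"
    using det by algebra+
  have cop: "coprime (p * a + q * b) (r * a + s * b)"
  proof (rule coprimeI)
    fix k assume "k dvd p * a + q * b" "k dvd r * a + s * b"
    then have "k dvd a" "k dvd b" by (metis a dvd_diff dvd_mult, metis b dvd_diff dvd_mult)
    then show "is_unit k" using ab by (meson coprime_common_divisor)
  qed
  have "moebius A v = ratio (p * a + q * b) (r * a + s * b)"
  proof (cases "b = 0")
    case True
    then have "a = 1 \<or> a = - 1" using ab by (auto simp: abs_eq_iff)
    then show ?thesis using True v by (auto simp: ratio_def pqrs)
  next
    case False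
    then have b0: "(of_int b :: rat) \<noteq> 0" by simp
    have "(of_int r * (of_int a / of_int b) + of_int s :: rat) = of_int (r * a + s * b) / of_int b"
      "(of_int p * (of_int a / of_int b) + of_int q :: rat) = of_int (p * a + q * b) / of_int b"
      using b0 by (simp_all add: field_simps)
    then show ?thesis using v False b0
      by (simp add: ratio_def flip: pqrs del: of_int_add of_int_mult)
  qed
  with cop show ?thesis by (simp add: reduced_rep_def pqrs)
qed

lemma moebius_mult:
  assumes "A \<in> SL2Z" "B \<in> SL2Z"
  shows "moebius (A ** B) v = moebius A (moebius B v)"
proof -
  obtain a b where ab: "reduced_rep v a b" using reduced_rep_exists by blast
  have "A ** B \<in> SL2Z" using assms by (simp add: SL2Z_def det_mul)
  from reduced_rep_moebius[OF this ab]
    reduced_rep_moebius[OF assms(1) reduced_rep_moebius[OF assms(2) ab]]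
  show ?thesis
    by (simp add: reduced_rep_def matrix_matrix_mult_def sum_2 algebra_simps)
qed

lemma moebius_one: "moebius (mat 1) v = v"
  by (cases v) (auto simp: mat_def)

lemma equiv_orbit_rel: "equiv farey_paths orbit_rel"
proof (rule equivI)
  show "refl_on farey_paths orbit_rel"
  proof (rule refl_onI)
    fix \<gamma> assume "\<gamma> \<in> farey_paths"
    moreover have "mat 1 \<in> SL2Z" "\<gamma> = (\<lambda>i. moebius (mat 1) (\<gamma> i))"
      by (auto simp: SL2Z_def moebius_one)
    ultimately show "(\<gamma>, \<gamma>) \<in> orbit_rel" unfolding orbit_rel_def by blast
  qed
  show "orbit_rel \<subseteq> farey_paths \<times> farey_paths"
    by (auto simp: orbit_rel_def)
  show "sym orbit_rel"
  proof (rule symI)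
    fix x y assume xy: "(x, y) \<in> orbit_rel"
    then obtain A where A: "A \<in> SL2Z" "y = (\<lambda>i. moebius A (x i))" by (auto simp: orbit_rel_def)
    define B :: "int ^ 2 ^ 2"
      where "B = vector [vector [A $ 2 $ 2, - A $ 1 $ 2], vector [- A $ 2 $ 1, A $ 1 $ 1]]"
    have B: "B \<in> SL2Z" using A by (simp add: SL2Z_def det_2 B_def algebra_simps)
    have "B ** A = mat 1"
      using A by (simp add: vec_eq_iff forall_2 matrix_matrix_mult_def sum_2 B_def mat_def SL2Z_def det_2 algebra_simps)
    then have "x = (\<lambda>i. moebius B (y i))"
      using moebius_mult[OF B A(1)] by (simp add: A(2) moebius_one flip: moebius_mult)
    with xy B show "(y, x) \<in> orbit_rel" by (auto simp: orbit_rel_def)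
  qed
  show "trans orbit_rel"
  proof (rule transI)
    fix x y z assume xy: "(x, y) \<in> orbit_rel" and yz: "(y, z) \<in> orbit_rel"
    then obtain A B where A: "A \<in> SL2Z" "y = (\<lambda>i. moebius A (x i))"
      and B: "B \<in> SL2Z" "z = (\<lambda>i. moebius B (y i))" by (auto simp: orbit_rel_def)
    have "B ** A \<in> SL2Z" "z = (\<lambda>i. moebius (B ** A) (x i))"
      using A B by (auto simp: SL2Z_def det_mul moebius_mult)
    with xy yz show "(x, z) \<in> orbit_rel" by (auto simp: orbit_rel_def)
  qed
qed

lemma moebius_path:
  assumes "A \<in> SL2Z" "\<gamma> \<in> farey_paths"
  shows "(\<lambda>i. moebius A (\<gamma> i)) \<in> farey_paths"
proof -
  have "farey_adj (moebius A (\<gamma> i)) (moebius A (\<gamma> (i + 1)))" for i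
  proof -
    obtain a b c d where r: "reduced_rep (\<gamma> i) a b" "reduced_rep (\<gamma> (i + 1)) c d"
      and *: "a * d - b * c = 1 \<or> a * d - b * c = - 1"
      using assms(2) unfolding farey_paths_def farey_adj_def by blast
    have "(A $ 1 $ 1 * a + A $ 1 $ 2 * b) * (A $ 2 $ 1 * c + A $ 2 $ 2 * d)
        - (A $ 2 $ 1 * a + A $ 2 $ 2 * b) * (A $ 1 $ 1 * c + A $ 1 $ 2 * d)
        = det A * (a * d - b * c)"
      by (simp add: det_2 algebra_simps)
    with * assms(1) show ?thesis
      using reduced_rep_moebius[OF assms(1) r(1)] reduced_rep_moebius[OF assms(1) r(2)]
      by (simp add: farey_adj_reduced_rep SL2Z_def)
  qed
  then show ?thesis by (simp add: farey_paths_def)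
qed

lemma normalised_reps_exists:
  assumes "\<gamma> \<in> farey_paths"
  shows "normalised_reps \<gamma> \<noteq> {}"
proof -
  obtain p q where pq: "\<And>i. reduced_rep (\<gamma> i) (p i) (q i)"
  proof -
    have "\<forall>i. \<exists>r. reduced_rep (\<gamma> i) (fst r) (snd r)"
      using reduced_rep_exists by simp
    then obtain r where "\<And>i. reduced_rep (\<gamma> i) (fst (r i)) (snd (r i))"
      by metis
    then show ?thesis by (rule that)
  qed
  define e where "e i = p i * q (i + 1) - p (i + 1) * q i" for i
  have e: "e i = 1 \<or> e i = - 1" for i
    using assms farey_adj_reduced_rep[OF pq[of i] pq[of "i + 1"]]
    by (auto simp: farey_paths_def e_def mult.commute)
  have ee: "e i * e i = 1" for i using e[of i] by auto
  define s where "s i = (if i \<ge> 0 then \<Prod>k\<in>{0..<i}. e k else \<Prod>k\<in>{i..<0}. e k)" for i :: int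
  have s: "s i = 1 \<or> s i = - 1" for i
  proof -
    have "(\<Prod>k\<in>K. e k) = 1 \<or> (\<Prod>k\<in>K. e k) = - 1" for K :: "int set"
    proof (induction K rule: infinite_finite_induct)
      case (insert x K)
      then show ?case using e[of x] by auto
    qed auto
    then show ?thesis by (simp add: s_def)
  qed
  have step: "s (i + 1) = s i * e i" for i
  proof (cases "i \<ge> 0")
    case True
    then have "{0..<i + 1} = insert i {0..<i}" by auto
    then show ?thesis using True by (simp add: s_def mult.commute)
  next
    case False
    then have "{i..<0} = insert i {i + 1..<0}" by auto
    moreover have "s (i + 1) = (\<Prod>k\<in>{i + 1..<0}. e k)"
      using False by (cases "i = - 1") (auto simp: s_def)
    ultimately show ?thesis using False ee[of i] by (simp add: s_def algebra_simps)
  qed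
  have "s i * p i * (s (i + 1) * q (i + 1)) - s (i + 1) * p (i + 1) * (s i * q i) = 1" for i
  proof -
    have "s i * p i * (s (i + 1) * q (i + 1)) - s (i + 1) * p (i + 1) * (s i * q i)
        = s i * s (i + 1) * e i"
      by (simp add: e_def algebra_simps)
    also have "\<dots> = (s i * s i) * (e i * e i)"
      by (simp add: step)
    finally show ?thesis using s[of i] ee[of i] by auto
  qed
  moreover have "reduced_rep (\<gamma> i) (s i * p i) (s i * q i)" for i
    using s[of i] pq[of i] reduced_rep_unique[OF pq[of i]] by auto
  ultimately have "(\<lambda>i. s i * p i, \<lambda>i. s i * q i) \<in> normalised_reps \<gamma>"
    by (auto simp: normalised_reps_def)
  then show ?thesis by blast
qed

lemma normalised_reps_unique:
  assumes "(a, b) \<in> normalised_reps \<gamma>" "(c, d) \<in> normalised_reps \<gamma>"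
  shows "(c = a \<and> d = b) \<or> (c = (\<lambda>i. - a i) \<and> d = (\<lambda>i. - b i))"
proof -
  have det: "a i * b (i + 1) - a (i + 1) * b i = 1" "c i * d (i + 1) - c (i + 1) * d i = 1" for i
    using assms by (auto simp: normalised_reps_def)
  have u: "(c i = a i \<and> d i = b i) \<or> (c i = - a i \<and> d i = - b i)" for i
    using assms reduced_rep_unique[of "\<gamma> i" "a i" "b i" "c i" "d i"]
    by (auto simp: normalised_reps_def)
  define P where "P i \<longleftrightarrow> c i = a i \<and> d i = b i" for i
  have step: "P (i + 1) \<longleftrightarrow> P i" for i
    using u[of i] u[of "i + 1"] det[of i] by (auto simp: P_def)
  have "P i \<longleftrightarrow> P 0" for i
  proof (induction i rule: int_induct[where k = 0])
    case (step2 i)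
    then show ?case using step[of "i - 1"] by simp
  qed (use step in auto)
  then have "(\<forall>i. P i) \<or> (\<forall>i. \<not> P i)" by blast
  then show ?thesis
  proof
    assume "\<forall>i. P i"
    then show ?thesis by (simp add: P_def fun_eq_iff)
  next
    assume "\<forall>i. \<not> P i"
    then have "c i = - a i \<and> d i = - b i" for i using u[of i] by (auto simp: P_def)
    then show ?thesis by (simp add: fun_eq_iff)
  qed
qed

lemma frieze_of_tame_frieze:
  assumes "(a, b) \<in> normalised_reps \<gamma>"
  shows "frieze_of a b \<in> tame_friezes"
proof -
  have det: "a i * b (i + 1) - a (i + 1) * b i = 1" for i
    using assms by (auto simp: normalised_reps_def)
  have "frieze_of a b i j * frieze_of a b (i + 1) (j + 1)
      - frieze_of a b i (j + 1) * frieze_of a b (i + 1) j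
      = (a i * b (i + 1) - a (i + 1) * b i) * (a j * b (j + 1) - a (j + 1) * b j)" for i j
    by (simp add: frieze_of_def algebra_simps)
  then have "SL2_tiling (frieze_of a b)" by (simp add: SL2_tiling_def det)
  moreover have "tame (frieze_of a b)"
    by (simp add: tame_def det_3 frieze_of_def algebra_simps)
  ultimately show ?thesis
    by (simp add: tame_friezes_def infinite_frieze_def frieze_of_def)
qed

lemma uminus_tame_frieze:
  assumes "M \<in> tame_friezes"
  shows "(\<lambda>i j. - M i j) \<in> tame_friezes"
proof -
  have M: "SL2_tiling M" "tame M" and anti: "\<And>i j. M j i = - M i j"
    using assms unfolding tame_friezes_def infinite_frieze_def by blast+
  have "SL2_tiling (\<lambda>i j. - M i j)"
    using M(1) by (simp add: SL2_tiling_def)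
  moreover have "tame (\<lambda>i j. - M i j)"
    using M(2) by (simp add: tame_def det_3 algebra_simps)
  moreover have "- M j i = - (- M i j)" for i j
    using anti[of j i] by simp
  ultimately show ?thesis unfolding tame_friezes_def infinite_frieze_def by blast
qed

lemma sign_class:
  "M \<in> tame_friezes \<Longrightarrow> sign_rel `` {M} = {M, \<lambda>i j. - M i j}"
  by (auto simp: sign_rel_def uminus_tame_frieze)

lemma Phi_orbit:
  assumes "\<gamma> \<in> farey_paths" "(a, b) \<in> normalised_reps \<gamma>"
  shows "Phi (orbit_rel `` {\<gamma>}) = {frieze_of a b, \<lambda>i j. - frieze_of a b i j}"
proof -
  have eq: "frieze_of c d = frieze_of a b"
    if rel: "(\<gamma>, \<delta>) \<in> orbit_rel" and cd: "(c, d) \<in> normalised_reps \<delta>" for \<delta> c d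
  proof -
    obtain A where A: "A \<in> SL2Z" and \<delta>: "\<delta> = (\<lambda>i. moebius A (\<gamma> i))"
      using rel by (auto simp: orbit_rel_def)
    define a' b' where "a' = (\<lambda>i. A $ 1 $ 1 * a i + A $ 1 $ 2 * b i)"
      and "b' = (\<lambda>i. A $ 2 $ 1 * a i + A $ 2 $ 2 * b i)"
    have *: "a' i * b' j - a' j * b' i = a i * b j - a j * b i" for i j
    proof -
      have "a' i * b' j - a' j * b' i = det A * (a i * b j - a j * b i)"
        by (simp add: a'_def b'_def det_2 algebra_simps)
      then show ?thesis using A by (simp add: SL2Z_def)
    qed
    have "(a', b') \<in> normalised_reps \<delta>"
      using assms(2) * reduced_rep_moebius[OF A]
      by (auto simp: normalised_reps_def \<delta>) (auto simp: a'_def b'_def)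
    from normalised_reps_unique[OF this cd]
    have "frieze_of c d = frieze_of a' b'" by (auto simp: frieze_of_def)
    also have "\<dots> = frieze_of a b"
      using * by (simp add: frieze_of_def fun_eq_iff algebra_simps)
    finally show ?thesis .
  qed
  have "(\<gamma>, \<gamma>) \<in> orbit_rel"
    using equiv_orbit_rel assms(1) by (meson equiv_class_self Image_singleton_iff)
  have "Phi (orbit_rel `` {\<gamma>}) = sign_rel `` {frieze_of a b}"
  proof (intro equalityI)
    show "Phi (orbit_rel `` {\<gamma>}) \<subseteq> sign_rel `` {frieze_of a b}"
    proof
      fix N assume "N \<in> Phi (orbit_rel `` {\<gamma>})"
      then obtain \<delta> c d where "(\<gamma>, \<delta>) \<in> orbit_rel" "(c, d) \<in> normalised_reps \<delta>"
        and N: "N \<in> sign_rel `` {frieze_of c d}"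
        unfolding Phi_def by blast
      with eq have "frieze_of c d = frieze_of a b" by blast
      with N show "N \<in> sign_rel `` {frieze_of a b}" by simp
    qed
    show "sign_rel `` {frieze_of a b} \<subseteq> Phi (orbit_rel `` {\<gamma>})"
      using \<open>(\<gamma>, \<gamma>) \<in> orbit_rel\<close> assms(2) unfolding Phi_def by blast
  qed
  then show ?thesis using sign_class frieze_of_tame_frieze assms(2) by simp
qed

end

theory Submission
  imports Defs
begin

text \<open>
  A normalised path is a sequence of vectors in \<open>\<int>\<^sup>2\<close> whose consecutive members form bases of
  determinant \<open>1\<close>, and its frieze records all the pairwise determinants.  Since each vector is
  determined by its determinants with the first two, equal friezes differ by the element of
  \<open>SL\<^sub>2(\<int>)\<close> that matches the first two vectors.  Conversely, tameness forces the rows of a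
  frieze \<open>M\<close> to satisfy a three-term recurrence, and by antisymmetry its columns satisfy the same
  one; hence \<open>M\<close> is the frieze of the path read off from rows \<open>0\<close> and \<open>1\<close>.
\<close>

lemma int_constant:
  assumes "\<And>i :: int. f (i + 1) = f i"
  shows "f i = f 0"
proof (induction i rule: int_induct[where k = 0])
  case (step2 i)
  then show ?case using assms[of "i - 1"] by simp
qed (use assms in auto)

text \<open>Since \<open>f i\<close> enters with coefficient -1, the recurrence also runs backwards,
  so two neighbouring zeros spread in both directions.\<close>

lemma int_recurrence_zero:
  fixes f :: "int \<Rightarrow> int"
  assumes rec: "\<And>i. f (i + 2) = k i * f (i + 1) - f i" and "f 0 = 0" "f 1 = 0"
  shows "f i = 0"
proof -
  have "f i = 0 \<and> f (i + 1) = 0"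
  proof (induction i rule: int_induct[where k = 0])
    case base
    then show ?case using assms by simp
  next
    case (step1 i)
    then show ?case using rec[of i] by (simp add: add.commute)
  next
    case (step2 i)
    then show ?case using rec[of "i - 1"] by (simp add: add.commute)
  qed
  then show ?thesis ..
qed

text \<open>The 2 x 2 determinants of rows \<open>i\<close>, \<open>i + 1\<close> and of rows
  \<open>i + 1\<close>, \<open>i + 2\<close> are both 1, so they cancel in that of row
  \<open>i + 1\<close> with the sum \<open>r\<close> of its two neighbours. Hence \<open>r\<close>
  is locally a multiple of row \<open>i + 1\<close>, and tameness makes the factor the same in all
  columns.\<close>

lemma tame_rows_recurrence:
  assumes "SL2_tiling M" "tame M"
  obtains k where "\<And>j. M (i + 2) j = k * M (i + 1) j - M i j"
proof -
  define p q r where "p = M i" and "q = M (i + 1)" and "r = (\<lambda>j. M (i + 2) j + M i j)"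
  \<comment> \<open>Cramer's rule: pairing \<open>r = K * q\<close> with \<open>p\<close> isolates
    the factor, because \<open>p\<close> and \<open>q\<close> have determinant 1.\<close>
  define K where "K j = p j * r (j + 1) - p (j + 1) * r j" for j
  have pq: "p j * q (j + 1) - p (j + 1) * q j = 1" for j
    using assms(1) by (simp add: SL2_tiling_def p_def q_def)
  have qM: "q j * M (i + 2) (j + 1) - q (j + 1) * M (i + 2) j = 1" for j
    using assms(1)[unfolded SL2_tiling_def, rule_format, of "i + 1" j]
    by (simp add: q_def add.assoc)
  have qr: "q j * r (j + 1) = q (j + 1) * r j" for j
    using pq[of j] qM[of j] unfolding r_def p_def by algebra
  have r0: "r j = K j * q j" and r1: "r (j + 1) = K j * q (j + 1)" for j
    using pq[of j] qr[of j] unfolding K_def by algebra+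
  have r2: "r (j + 2) = K j * q (j + 2)" for j
  proof -
    \<comment> \<open>Adding the first row of the tame 3 x 3 block to its third leaves the
      determinant 0; this is its expansion along \<open>p\<close>.\<close>
    have "p j * (q (j + 1) * r (j + 2) - q (j + 2) * r (j + 1))
        - p (j + 1) * (q j * r (j + 2) - q (j + 2) * r j)
        + p (j + 2) * (q j * r (j + 1) - q (j + 1) * r j) = 0"
      using assms(2)[unfolded tame_def det_3, rule_format, of i j]
      by (simp add: p_def q_def r_def algebra_simps)
    then have "(p j * q (j + 1) - p (j + 1) * q j) * (r (j + 2) - K j * q (j + 2)) = 0"
      unfolding r0[of j] r1[of j] by (simp add: algebra_simps)
    then show ?thesis by (simp add: pq)
  qed
  have "K (j + 1) = K j" for j
  proof -
    have "K (j + 1) = K j * (p (j + 1) * q (j + 2) - p (j + 2) * q (j + 1))"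
      using r1[of j] r2[of j] K_def[of "j + 1"] by (simp add: add.assoc right_diff_distrib)
    then show ?thesis using pq[of "j + 1"] by (simp add: add.assoc)
  qed
  then have "K j = K 0" for j by (rule int_constant)
  then have "r j = K 0 * q j" for j using r0[of j] by simp
  then show ?thesis
    by (intro that[of "K 0"]) (simp add: r_def q_def eq_diff_eq)
qed

text \<open>This is the Pluecker relation for the indices 0, 1, \<open>i\<close>, \<open>j\<close>.
  For fixed \<open>j\<close> both sides obey the same recurrence in \<open>i\<close>, and they agree
  at \<open>i = 0\<close> and \<open>i = 1\<close>.\<close>

lemma tame_frieze_plucker:
  assumes "M \<in> tame_friezes" and M01: "M 0 1 = - 1"
  shows "M i j = M 0 j * M 1 i - M 0 i * M 1 j"
proof -
  have M: "SL2_tiling M" "tame M" and anti: "\<And>i j. M j i = - M i j"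
    using assms unfolding tame_friezes_def infinite_frieze_def by blast+
  have M00: "M i i = 0" for i using anti[of i i] by simp
  have M10: "M 1 0 = 1" using anti[of 1 0] M01 by simp
  have "\<forall>i. \<exists>k. \<forall>j. M (i + 2) j = k * M (i + 1) j - M i j"
    using tame_rows_recurrence[OF M] by metis
  then obtain k where row: "\<And>i j. M (i + 2) j = k i * M (i + 1) j - M i j"
    by metis
  have col: "M x (i + 2) = k i * M x (i + 1) - M x i" for x i
    using row[of i x] by (simp add: anti[of x])
  have "M i j - (M 0 j * M 1 i - M 0 i * M 1 j) = 0"
    by (rule int_recurrence_zero[where k = k])
      (simp_all add: row col M00 M10 M01 algebra_simps)
  then show ?thesis by simp
qed

lemma tame_frieze_diagonal:
  assumes "M \<in> tame_friezes"
  shows "M 0 1 = - 1 \<or> M 0 1 = 1"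
proof -
  have M: "SL2_tiling M" and anti: "\<And>i j. M j i = - M i j"
    using assms unfolding tame_friezes_def infinite_frieze_def by blast+
  have "M 0 0 = 0" using anti[of 0 0] by simp
  then have "M 0 1 * M 0 1 = 1"
    using M[unfolded SL2_tiling_def, rule_format, of 0 0] anti[of 0 1] by simp
  then show ?thesis by (auto simp: zmult_eq_1_iff)
qed

lemma normalised_reps_ratio:
  assumes "\<And>i. a i * b (i + 1) - a (i + 1) * b i = 1"
  shows "(a, b) \<in> normalised_reps (\<lambda>i. ratio (a i) (b i))"
    and "(\<lambda>i. ratio (a i) (b i)) \<in> farey_paths"
proof -
  have "coprime (a i) (b i)" for i
  proof (rule coprimeI)
    fix d assume "d dvd a i" "d dvd b i"
    then have "d dvd a i * b (i + 1) - a (i + 1) * b i" by simp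
    then show "is_unit d" by (simp add: assms)
  qed
  then have red: "reduced_rep (ratio (a i) (b i)) (a i) (b i)" for i
    by (simp add: reduced_rep_def)
  then show "(a, b) \<in> normalised_reps (\<lambda>i. ratio (a i) (b i))"
    using assms by (simp add: normalised_reps_def)
  show "(\<lambda>i. ratio (a i) (b i)) \<in> farey_paths"
    using assms by (simp add: farey_paths_def farey_adj_reduced_rep[OF red red] mult.commute)
qed

lemma frieze_of_surj:
  assumes "M \<in> tame_friezes" and M01: "M 0 1 = - 1"
  obtains \<gamma> a b where "\<gamma> \<in> farey_paths" "(a, b) \<in> normalised_reps \<gamma>" "frieze_of a b = M"
proof -
  \<comment> \<open>Forced by choosing (1, 0) and (0, 1) as the vectors at 0 and 1, that is, a path
    through infinity and then 0.\<close>
  define a b where "a = M 1" and "b = (\<lambda>j. - M 0 j)"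
  have M: "SL2_tiling M"
    using assms(1) unfolding tame_friezes_def infinite_frieze_def by blast
  have "a i * b (i + 1) - a (i + 1) * b i = 1" for i
    using M[unfolded SL2_tiling_def, rule_format, of 0 i]
    by (simp add: a_def b_def algebra_simps)
  note path = normalised_reps_ratio[of a b, OF this]
  have "frieze_of a b = M"
    using tame_frieze_plucker[OF assms]
    by (simp add: fun_eq_iff frieze_of_def a_def b_def algebra_simps)
  with path show ?thesis using that by blast
qed

lemma frieze_of_inj:
  assumes \<gamma>: "\<gamma> \<in> farey_paths" and \<delta>: "\<delta> \<in> farey_paths"
    and ab: "(a, b) \<in> normalised_reps \<gamma>" and cd: "(c, d) \<in> normalised_reps \<delta>"
    and eq: "frieze_of c d = frieze_of a b"
  shows "(\<gamma>, \<delta>) \<in> orbit_rel"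
proof -
  have det: "a 0 * b 1 - a 1 * b 0 = 1" "c 0 * d 1 - c 1 * d 0 = 1"
    using ab cd by (auto simp: normalised_reps_def dest!: spec[of _ 0])
  have m: "c j * d i - d j * c i = a j * b i - b j * a i" for i j
    using fun_cong[OF fun_cong[OF eq, of i], of j] by (simp add: frieze_of_def)
  \<comment> \<open>The matrix with columns (c 0, d 0), (c 1, d 1) times the inverse of the one with
    columns (a 0, b 0), (a 1, b 1).\<close>
  define A :: "int ^ 2 ^ 2" where
    "A = vector [vector [c 0 * b 1 - c 1 * b 0, c 1 * a 0 - c 0 * a 1],
                 vector [d 0 * b 1 - d 1 * b 0, d 1 * a 0 - d 0 * a 1]]"
  have "det A = (c 0 * d 1 - c 1 * d 0) * (a 0 * b 1 - a 1 * b 0)"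
    by (simp add: A_def det_2 algebra_simps)
  then have A: "A \<in> SL2Z" by (simp add: SL2Z_def det)
  have Aa: "A $ 1 $ 1 * a i + A $ 1 $ 2 * b i = c i" for i
  proof -
    have "A $ 1 $ 1 * a i + A $ 1 $ 2 * b i
        = c 0 * (a i * b 1 - b i * a 1) - c 1 * (a i * b 0 - b i * a 0)"
      by (simp add: A_def algebra_simps)
    \<comment> \<open>Both brackets are frieze entries, so \<open>m\<close> replaces them by the
      same expressions in \<open>c\<close> and \<open>d\<close>.\<close>
    also have "\<dots> = c i * (c 0 * d 1 - c 1 * d 0)"
      unfolding m[symmetric] by (simp add: algebra_simps)
    finally show ?thesis by (simp add: det)
  qed
  have Ab: "A $ 2 $ 1 * a i + A $ 2 $ 2 * b i = d i" for i
  proof -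
    have "A $ 2 $ 1 * a i + A $ 2 $ 2 * b i
        = d 0 * (a i * b 1 - b i * a 1) - d 1 * (a i * b 0 - b i * a 0)"
      by (simp add: A_def algebra_simps)
    also have "\<dots> = d i * (c 0 * d 1 - c 1 * d 0)"
      unfolding m[symmetric] by (simp add: algebra_simps)
    finally show ?thesis by (simp add: det)
  qed
  have "\<delta> i = moebius A (\<gamma> i)" for i
  proof -
    have "reduced_rep (\<gamma> i) (a i) (b i)" "reduced_rep (\<delta> i) (c i) (d i)"
      using ab cd by (auto simp: normalised_reps_def)
    then show ?thesis
      using reduced_rep_moebius[OF A, of "\<gamma> i" "a i" "b i"]
      by (simp add: Aa Ab reduced_rep_def)
  qed
  then have "\<delta> = (\<lambda>i. moebius A (\<gamma> i))" by (simp add: fun_eq_iff)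
  then show ?thesis using \<gamma> \<delta> A unfolding orbit_rel_def by blast
qed

text \<open>This entry tells \<open>M\<close> from \<open>- M\<close>, so equal sign classes of two
  paths come from equal friezes.\<close>

lemma frieze_of_01:
  "(a, b) \<in> normalised_reps \<gamma> \<Longrightarrow> frieze_of a b 0 1 = - 1"
  by (auto simp: normalised_reps_def frieze_of_def algebra_simps dest!: spec[of _ 0])

lemma inj_on_Phi: "inj_on Phi (farey_paths // orbit_rel)"
proof (rule inj_onI)
  fix X Y assume X: "X \<in> farey_paths // orbit_rel" and Y: "Y \<in> farey_paths // orbit_rel"
    and eq: "Phi X = Phi Y"
  obtain \<gamma> where \<gamma>: "\<gamma> \<in> farey_paths" "X = orbit_rel `` {\<gamma>}" using X by (rule quotientE)
  obtain \<delta> where \<delta>: "\<delta> \<in> farey_paths" "Y = orbit_rel `` {\<delta>}" using Y by (rule quotientE)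
  obtain a b where ab: "(a, b) \<in> normalised_reps \<gamma>"
    using normalised_reps_exists[OF \<gamma>(1)] by auto
  obtain c d where cd: "(c, d) \<in> normalised_reps \<delta>"
    using normalised_reps_exists[OF \<delta>(1)] by auto
  have "frieze_of c d \<in> {frieze_of a b, \<lambda>i j. - frieze_of a b i j}"
    using eq Phi_orbit[OF \<gamma>(1) ab] Phi_orbit[OF \<delta>(1) cd] by (simp add: \<gamma> \<delta>)
  moreover have "frieze_of c d \<noteq> (\<lambda>i j. - frieze_of a b i j)"
    using frieze_of_01[OF ab] frieze_of_01[OF cd] by auto
  ultimately have "(\<gamma>, \<delta>) \<in> orbit_rel" using frieze_of_inj[OF \<gamma>(1) \<delta>(1) ab cd] by blast
  then show "X = Y" using equiv_class_eq[OF equiv_orbit_rel] by (simp add: \<gamma> \<delta>)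
qed

lemma Phi_in_FR_inf:
  assumes "X \<in> farey_paths // orbit_rel"
  shows "Phi X \<in> FR_inf"
proof -
  obtain \<gamma> where \<gamma>: "\<gamma> \<in> farey_paths" "X = orbit_rel `` {\<gamma>}" using assms by (rule quotientE)
  obtain a b where ab: "(a, b) \<in> normalised_reps \<gamma>"
    using normalised_reps_exists[OF \<gamma>(1)] by auto
  note M = frieze_of_tame_frieze[OF ab]
  have "Phi X = sign_rel `` {frieze_of a b}"
    unfolding \<gamma>(2) Phi_orbit[OF \<gamma>(1) ab] sign_class[OF M] ..
  then show ?thesis using quotientI[OF M, of sign_rel] by (simp add: FR_inf_def)
qed

lemma Phi_surj:
  assumes "F \<in> FR_inf"
  shows "F \<in> Phi ` (farey_paths // orbit_rel)"
proof -
  obtain M where M: "M \<in> tame_friezes" "F = sign_rel `` {M}"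
    using assms unfolding FR_inf_def by (rule quotientE)
  \<comment> \<open>Only the representative with entry -1 at (0, 1) can be the frieze of a
    normalised path, so the sign is fixed first.\<close>
  obtain N where N: "N \<in> tame_friezes" "N 0 1 = - 1" "F = {N, \<lambda>i j. - N i j}"
  proof (cases "M 0 1 = - 1")
    case True
    then show ?thesis using that[of M] M sign_class by simp
  next
    case False
    then have "M 0 1 = 1" using tame_frieze_diagonal[OF M(1)] by simp
    then show ?thesis
      using that[of "\<lambda>i j. - M i j"] M sign_class uminus_tame_frieze by auto
  qed
  obtain \<gamma> a b where \<gamma>: "\<gamma> \<in> farey_paths" and ab: "(a, b) \<in> normalised_reps \<gamma>"
    and "frieze_of a b = N"
    using frieze_of_surj[OF N(1,2)] by blast
  then have "F = Phi (orbit_rel `` {\<gamma>})"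
    using Phi_orbit[OF \<gamma> ab] N(3) by simp
  then show ?thesis using quotientI[OF \<gamma>] by (rule image_eqI)
qed

theorem theorem1p3: "bij_betw Phi (farey_paths // orbit_rel) FR_inf"
  using inj_on_Phi Phi_in_FR_inf Phi_surj unfolding bij_betw_def by blast

end
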